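(* Let $n\ge 0$ be an integer and let $P_n(z)=\sum_{j=0}^n \eta_j f_j(z)$, where $\eta_0,\dots,\eta_n$ are complex-valued i.i.d. standard Gaussian random variables and $f_0,\dots,f_n$ are orthogonal polynomials of one of the two types below. Let $\rho_n$ be the intensity function associated with $P_n$, $$\rho_n(z)=\frac{K_{n}^{(1,1)}(z,z)\,K_{n}(z,z)-\left|K_{n}^{(0,1)}(z,z)\right|^2}{\pi \left(K_{n}(z,z)\right)^2},$$ where $K_n(z,w)=\sum_{j=0}^{n}f_j(z)\overline{f_j(w)}$, $K_{n}^{(0,1)}(z,w)=\sum_{j=0}^{n} f_j(z)\overline{f_j'(w)}$ and $K_{n}^{(1,1)}(z,w)=\sum_{j=0}^{n}f_j'(z)\overline{f_j'(w)}$. 1. Suppose $f_j=p_j$ for $j=0,\dots,n$, where $\{p_j\}_{j\ge 0}$ are orthonormal polynomials on the real line with respect to a measure $\mu$ with $\operatorname{supp}\mu\subseteq\mathbb{R}$. Then for $z\in\mathbb{C}$, $$\rho_n(z)=\frac{1-h_n(z)^2}{4\pi\left(\operatorname{Im}(z)\right)^2},\qquad h_n(z)=\frac{\operatorname{Im}(z)\,|a_n'(z)|}{\operatorname{Im}(a_n(z))},\qquad a_n(z)=\frac{p_{n+1}(z)}{p_n(z)},$$ where for $z\in\mathbb{R}$ the right-hand side is understood as its continuous extension from $\mathbb{C}\setminus\mathbb{R}$. 2. Suppose $f_j=\varphi_j$ for $j=0,\dots,n$, where $\{\varphi_j\}_{j\ge 0}$ are orthonormal polynomials on the unit circle associated with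 a conjugate-symmetric probability Borel measure $\mu$ on the unit circle. Then for every $z\in\mathbb{C}$ with $|z|\neq 1$, $$\rho_n(z)=\frac{1-|k_{n}(z)|^2}{\pi (1-|z|^2)^2},\qquad k_{n}(z)=\frac{(1-|z|^2)\,b_{n}'(z)}{1-|b_{n}(z)|^2},\qquad b_{n}(z)=\frac{\varphi_{n+1}(z)}{\varphi_{n+1}^*(z)},$$ where $\varphi_{m}^{*}(z)=z^{m}\,\overline{\varphi_{m}(1/\bar z)}$, and where at the zeros of $\varphi_{n+1}^*$ (the poles of $b_n$, all lying in $|z|>1$) the quantity $|k_n(z)|$ is understood as its continuous extension.
   Context: A complex-valued standard Gaussian random variable here is $\eta=\alpha+i\beta$ with $\alpha,\beta$ independent standard real Gaussians; the families $\{\alpha_j\}$, $\{\beta_j\}$ giving $\eta_j=\alpha_j+i\beta_j$ are all independent. Orthonormal polynomials on the real line (OPRL): $\mu$ is a positive measure supported on an infinite subset of $\mathbb{R}$ with finite moments; $p_j$ is a polynomial of degree exactly $j$ with real coefficients and positive leading coefficient, and $\int p_m p_k\,d\mu=\delta_{mk}$ for all $m,k\ge 0$. Orthonormal polynomials on the unit circle (OPUC): $\mu$ is a probability Borel measure on $\mathbb{T}=\{|z|=1\}$ with infinite support; $\varphi_j$ is a polynomial of degree exactly $j$ with positive leading coefficient, and $\int_{\mathbb{T}}\varphi_m\overline{\varphi_k}\,d\mu=\delta_{mk}$ for all $m,k\ge0$. "Conjugate-symmetric" means that $\mu$ is invariant under $z\mapsto\bar z$; then the $\varphi_j$ have real coefficients.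 The function $\rho_n$ is the density of the expected number of zeros of $P_n$: for each Jordan region $\Omega$ in $\mathbb{C}$ the expected number of zeros of $P_n$ in $\Omega$ equals $\int_\Omega\rho_n\,dx\,dy$; in this statement $\rho_n$ is taken to be given by the displayed kernel formula. Since $f_0$ is a nonzero constant, $K_n(z,z)>0$ for all $z\in\mathbb{C}$, so $\rho_n$ is continuous on $\mathbb{C}$. *)

theory Defs
  imports "HOL-Probability.Probability" "HOL-Computational_Algebra.Polynomial"
begin

definition measure_support :: "'a::topological_space measure \<Rightarrow> 'a set" where
  "measure_support \<mu> = {x. \<forall>U. open U \<and> x \<in> U \<longrightarrow> emeasure \<mu> U > 0}"

definition oprl :: "real measure \<Rightarrow> (nat \<Rightarrow> real poly) \<Rightarrow> bool" where
  "oprl \<mu> p \<longleftrightarrow>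
     sets \<mu> = sets borel \<and>
     infinite (measure_support \<mu>) \<and>
     (\<forall>k. integrable \<mu> (\<lambda>x. x ^ k)) \<and>
     (\<forall>j. degree (p j) = j \<and> lead_coeff (p j) > 0) \<and>
     (\<forall>m k. (LINT x|\<mu>. poly (p m) x * poly (p k) x) = (if m = k then 1 else 0))"

text \<open>
  A measure on the unit circle is represented by a Borel measure on the complex plane
  concentrated on the circle. Leading coefficients are required to be positive reals; the
  remaining coefficients may be arbitrary complex numbers.
\<close>

definition opuc :: "complex measure \<Rightarrow> (nat \<Rightarrow> complex poly) \<Rightarrow> bool" where
  "opuc \<mu> \<phi> \<longleftrightarrow>
     prob_space \<mu> \<and>
     sets \<mu> = sets borel \<and>
     (AE z in \<mu>. cmod z = 1) \<and>
     infinite (measure_support \<mu>) \<and>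
     (\<forall>j. degree (\<phi> j) = j \<and> (\<exists>c>0. lead_coeff (\<phi> j) = complex_of_real c)) \<and>
     (\<forall>m k. (LINT z|\<mu>. poly (\<phi> m) z * cnj (poly (\<phi> k) z)) = (if m = k then 1 else 0))"

definition conjugate_symmetric :: "complex measure \<Rightarrow> bool" where
  "conjugate_symmetric \<mu> \<longleftrightarrow> distr \<mu> borel cnj = \<mu>"

text \<open>
  The polynomial $z^m \overline{p(1/\bar z)}$ with $m$ the degree of $p$ (see
  \<open>poly_star_poly\<close>); being a polynomial, it also has the right value at $0$, where the
  formula itself is not meaningful.
\<close>

definition star_poly :: "complex poly \<Rightarrow> complex poly" where
  "star_poly p = reflect_poly (map_poly cnj p)"

lemma poly_star_poly:
  assumes "degree p = m" "z \<noteq> 0"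
  shows "poly (star_poly p) z = z ^ m * cnj (poly p (1 / cnj z))"
proof -
  have deg: "degree (map_poly cnj p) = m"
    using assms(1) by (simp add: degree_map_poly)
  have "poly (map_poly cnj p) (inverse z) = cnj (poly p (1 / cnj z))"
    by (simp add: poly_altdef degree_map_poly coeff_map_poly divide_inverse)
  with deg show ?thesis
    using assms(2) by (simp add: star_poly_def poly_reflect_poly_nz)
qed

definition std_complex_gaussians ::
    "'a measure \<Rightarrow> 'i set \<Rightarrow> ('i \<Rightarrow> 'a \<Rightarrow> complex) \<Rightarrow> bool" where
  "std_complex_gaussians M I \<eta> \<longleftrightarrow>
     prob_space M \<and>
     prob_space.indep_vars M (\<lambda>_. borel)
       (case_sum (\<lambda>j \<omega>. Re (\<eta> j \<omega>)) (\<lambda>j \<omega>. Im (\<eta> j \<omega>))) (I <+> I) \<and>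
     (\<forall>j\<in>I. distributed M lborel (\<lambda>\<omega>. Re (\<eta> j \<omega>)) std_normal_density \<and>
            distributed M lborel (\<lambda>\<omega>. Im (\<eta> j \<omega>)) std_normal_density)"

definition kernel :: "nat \<Rightarrow> (nat \<Rightarrow> complex poly) \<Rightarrow> complex \<Rightarrow> complex \<Rightarrow> complex" where
  "kernel n f z w = (\<Sum>j\<le>n. poly (f j) z * cnj (poly (f j) w))"

definition kernel01 :: "nat \<Rightarrow> (nat \<Rightarrow> complex poly) \<Rightarrow> complex \<Rightarrow> complex \<Rightarrow> complex" where
  "kernel01 n f z w = (\<Sum>j\<le>n. poly (f j) z * cnj (poly (pderiv (f j)) w))"

definition kernel11 :: "nat \<Rightarrow> (nat \<Rightarrow> complex poly) \<Rightarrow> complex \<Rightarrow> complex \<Rightarrow> complex" where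
  "kernel11 n f z w = (\<Sum>j\<le>n. poly (pderiv (f j)) z * cnj (poly (pderiv (f j)) w))"

text \<open>
  The intensity is a real number, but is typed as a complex number because the kernels are;
  equating it with an embedded real value thus includes its being real.
\<close>

definition intensity :: "nat \<Rightarrow> (nat \<Rightarrow> complex poly) \<Rightarrow> complex \<Rightarrow> complex" where
  "intensity n f z =
     (kernel11 n f z z * kernel n f z z - complex_of_real ((cmod (kernel01 n f z z))\<^sup>2)) /
     (complex_of_real pi * (kernel n f z z)\<^sup>2)"

definition oprl_ratio :: "(nat \<Rightarrow> real poly) \<Rightarrow> nat \<Rightarrow> complex \<Rightarrow> complex" where
  "oprl_ratio p n z =
     poly (map_poly complex_of_real (p (Suc n))) z / poly (map_poly complex_of_real (p n)) z"

definition oprl_h :: "(nat \<Rightarrow> real poly) \<Rightarrow> nat \<Rightarrow> complex \<Rightarrow> real" where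
  "oprl_h p n z = Im z * cmod (deriv (oprl_ratio p n) z) / Im (oprl_ratio p n z)"

definition opuc_ratio :: "(nat \<Rightarrow> complex poly) \<Rightarrow> nat \<Rightarrow> complex \<Rightarrow> complex" where
  "opuc_ratio \<phi> n z = poly (\<phi> (Suc n)) z / poly (star_poly (\<phi> (Suc n))) z"

definition opuc_k :: "(nat \<Rightarrow> complex poly) \<Rightarrow> nat \<Rightarrow> complex \<Rightarrow> complex" where
  "opuc_k \<phi> n z =
     complex_of_real (1 - (cmod z)\<^sup>2) * deriv (opuc_ratio \<phi> n) z /
     complex_of_real (1 - (cmod (opuc_ratio \<phi> n z))\<^sup>2)"

end

theory Submission
  imports Defs
begin

text \<open>
  Put $y = \bar w$. The Christoffel--Darboux formulas factor the kernel as $D K = G$ where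
  $D(x,y)$ and $G(x,y)$ both have the form $A(x) C(y) - B(x) E(y)$: on the line
  $D = x - y$, on the circle $D = 1 - x y$. The numerator of $\pi\rho_n$ is
  $K K_{xy} - K_x K_y = K^2 \partial_x \partial_y \log K$ at $y = \bar x$, and
  $\log K = \log G - \log D$. For a function of the above form, $G G_{xy} - G_x G_y$ is, up to
  sign, the product of the Wronskian of $A, B$ at $x$ and that of $C, E$ at $y$. Hence
  $|k_n| = |W| / K_n$ and, with the last Jacobi coefficient $c$, $h_n = c |W| / K_n$, where $W$ is
  the Wronskian of the numerator and denominator of $b_n$ or $a_n$. These quotients are
  continuous everywhere, which gives the exceptional points.
\<close>

subsection \<open>Wronskians and kernels\<close>

lemma pderiv_map_poly_cnj: "pderiv (map_poly cnj p) = map_poly cnj (pderiv p)"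
  by (intro poly_eqI) (simp add: coeff_pderiv coeff_map_poly)

text \<open>The sign makes this the numerator of the derivative of \<open>p / q\<close>.\<close>

definition wronskian :: "'a :: idom poly \<Rightarrow> 'a poly \<Rightarrow> 'a poly" where
  "wronskian p q = pderiv p * q - p * pderiv q"

text \<open>Write D F = G for \<open>factor\<close>. Then F F_xy - F_x F_y, multiplied by D^2, is
  the same expression in G minus F^2 times that in D, and each of these two splits into Wronskians.
  Nothing is divided, so zeros of D are harmless. The free \<open>a\<close>, \<open>b\<close>,
  \<open>c\<close>, \<open>d\<close> cover both x - y and 1 - xy.\<close>

lemma wronskian_of_factorization:
  fixes a b c d A B C E :: "'a :: real_normed_field poly" and f g :: "'i \<Rightarrow> 'a poly" and J :: "'i set"
  defines "F \<equiv> \<lambda>f g x y. \<Sum>j\<in>J. poly (f j) x * poly (g j) y"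
  assumes factor: "\<And>x y. (poly a x * poly c y - poly b x * poly d y) * F f g x y =
      poly A x * poly C y - poly B x * poly E y"
  shows "(poly a x * poly c y - poly b x * poly d y)\<^sup>2 *
      (F f g x y * F (\<lambda>j. pderiv (f j)) (\<lambda>j. pderiv (g j)) x y
        - F (\<lambda>j. pderiv (f j)) g x y * F f (\<lambda>j. pderiv (g j)) x y) =
      poly (wronskian A B) x * poly (wronskian E C) y -
      (F f g x y)\<^sup>2 * (poly (wronskian a b) x * poly (wronskian d c) y)"
proof -
  let ?f' = "\<lambda>j. pderiv (f j)" and ?g' = "\<lambda>j. pderiv (g j)"
  have Dx: "((\<lambda>x. F f h x y) has_field_derivative F ?f' h x y) (at x)" for h x y
    unfolding F_def by (auto intro!: derivative_eq_intros poly_DERIV sum.cong)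
  have Dy: "((\<lambda>y. F h g x y) has_field_derivative F h ?g' x y) (at y)" for h x y
    unfolding F_def by (auto intro!: derivative_eq_intros poly_DERIV sum.cong)
  note [derivative_intros] = Dx Dy poly_DERIV
  \<comment> \<open>Facts \<open>1\<close>, \<open>2\<close> and \<open>3\<close> are the x-, y- and
    mixed derivatives of \<open>factor\<close>; \<open>3\<close> differentiates \<open>1\<close> in
    y.\<close>
  have 1: "(poly (pderiv a) x * poly c y - poly (pderiv b) x * poly d y) * F f g x y +
      (poly a x * poly c y - poly b x * poly d y) * F ?f' g x y =
      poly (pderiv A) x * poly C y - poly (pderiv B) x * poly E y" for x y
  proof (rule DERIV_unique)
    show "((\<lambda>x. poly A x * poly C y - poly B x * poly E y) has_field_derivative
        poly (pderiv A) x * poly C y - poly (pderiv B) x * poly E y) (at x)"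
      by (auto intro!: derivative_eq_intros)
    show "((\<lambda>x. poly A x * poly C y - poly B x * poly E y) has_field_derivative
        (poly (pderiv a) x * poly c y - poly (pderiv b) x * poly d y) * F f g x y +
        (poly a x * poly c y - poly b x * poly d y) * F ?f' g x y) (at x)"
      unfolding factor[symmetric] by (auto intro!: derivative_eq_intros simp: algebra_simps)
  qed
  have 2: "(poly a x * poly (pderiv c) y - poly b x * poly (pderiv d) y) * F f g x y +
      (poly a x * poly c y - poly b x * poly d y) * F f ?g' x y =
      poly A x * poly (pderiv C) y - poly B x * poly (pderiv E) y" for x y
  proof (rule DERIV_unique)
    show "((\<lambda>y. poly A x * poly C y - poly B x * poly E y) has_field_derivative
        poly A x * poly (pderiv C) y - poly B x * poly (pderiv E) y) (at y)"
      by (auto intro!: derivative_eq_intros)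
    show "((\<lambda>y. poly A x * poly C y - poly B x * poly E y) has_field_derivative
        (poly a x * poly (pderiv c) y - poly b x * poly (pderiv d) y) * F f g x y +
        (poly a x * poly c y - poly b x * poly d y) * F f ?g' x y) (at y)"
      unfolding factor[symmetric] by (auto intro!: derivative_eq_intros simp: algebra_simps)
  qed
  have 3: "(poly (pderiv a) x * poly (pderiv c) y - poly (pderiv b) x * poly (pderiv d) y) * F f g x y +
      (poly (pderiv a) x * poly c y - poly (pderiv b) x * poly d y) * F f ?g' x y +
      (poly a x * poly (pderiv c) y - poly b x * poly (pderiv d) y) * F ?f' g x y +
      (poly a x * poly c y - poly b x * poly d y) * F ?f' ?g' x y =
      poly (pderiv A) x * poly (pderiv C) y - poly (pderiv B) x * poly (pderiv E) y"
  proof (rule DERIV_unique)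
    show "((\<lambda>y. poly (pderiv A) x * poly C y - poly (pderiv B) x * poly E y) has_field_derivative
        poly (pderiv A) x * poly (pderiv C) y - poly (pderiv B) x * poly (pderiv E) y) (at y)"
      by (auto intro!: derivative_eq_intros)
    show "((\<lambda>y. poly (pderiv A) x * poly C y - poly (pderiv B) x * poly E y) has_field_derivative
        (poly (pderiv a) x * poly (pderiv c) y - poly (pderiv b) x * poly (pderiv d) y) * F f g x y +
      (poly (pderiv a) x * poly c y - poly (pderiv b) x * poly d y) * F f ?g' x y +
      (poly a x * poly (pderiv c) y - poly b x * poly (pderiv d) y) * F ?f' g x y +
      (poly a x * poly c y - poly b x * poly d y) * F ?f' ?g' x y) (at y)"
      unfolding 1[symmetric] by (auto intro!: derivative_eq_intros simp: algebra_simps)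
  qed
  show ?thesis
    \<comment> \<open>For G = A(x) C(y) - B(x) E(y), expansion gives G G_xy - G_x G_y = W(A,B)(x)
      W(E,C)(y), and likewise for D.\<close>
    using 1[of x y] 2[of x y] 3 factor[of x y]
    unfolding wronskian_def poly_diff poly_mult by algebra
qed

lemma eq_of_real_divideI:
  fixes t :: complex
  assumes "x \<noteq> 0" "complex_of_real x * t = complex_of_real y"
  shows "t = complex_of_real (y / x)"
  using assms by (simp add: eq_divide_eq mult.commute)

lemma deriv_poly_quotient:
  assumes "poly q z \<noteq> 0"
  shows "deriv (\<lambda>z. poly p z / poly q z) z = poly (wronskian p q) z / (poly q z)\<^sup>2"
  using assms
  by (intro DERIV_imp_deriv)
    (auto intro!: derivative_eq_intros poly_DERIV simp: wronskian_def power2_eq_square)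

text \<open>A sum of squared moduli whose term at 0 is the square of a nonzero constant.\<close>

lemma kernel_diag:
  assumes "degree (f 0) = 0" "f 0 \<noteq> 0"
  obtains k where "k > 0" "kernel n f z z = complex_of_real k"
proof
  show "kernel n f z z = complex_of_real (\<Sum>j\<le>n. (cmod (poly (f j) z))\<^sup>2)"
    by (simp add: kernel_def flip: complex_norm_square)
  obtain c where "f 0 = [:c:]"
    using assms(1) degree_eq_zeroE by blast
  then have "poly (f 0) z \<noteq> 0"
    using assms(2) by auto
  then show "(\<Sum>j\<le>n. (cmod (poly (f j) z))\<^sup>2) > 0"
    by (intro sum_pos2[of _ 0]) auto
qed

lemma continuous_kernel:
  "continuous_on S (\<lambda>z. kernel n f z z)" "continuous_on S (\<lambda>z. kernel01 n f z z)"
  "continuous_on S (\<lambda>z. kernel11 n f z z)"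
  unfolding kernel_def kernel01_def kernel11_def by (intro continuous_intros)+

lemma isCont_intensity:
  assumes "degree (f 0) = 0" "f 0 \<noteq> 0"
  shows "isCont (intensity n f) z"
proof -
  have "kernel n f w w \<noteq> 0" for w
    using kernel_diag[of f n w] assms by (metis less_irrefl of_real_eq_0_iff)
  then have "continuous_on UNIV (intensity n f)"
    unfolding intensity_def by (intro continuous_intros continuous_kernel) auto
  then show ?thesis
    by (simp add: continuous_on_eq_continuous_at)
qed

text \<open>Conjugating coefficients turns the dependence on \<open>cnj w\<close> into a polynomial
  one in y = \<open>cnj w\<close>, so \<open>wronskian_of_factorization\<close> applies at y =
  \<open>cnj z\<close>.\<close>

lemma wronskian_of_kernel:
  assumes "\<And>z w. (poly a z * cnj (poly c w) - poly b z * cnj (poly d w)) * kernel n f z w =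
      poly A z * cnj (poly C w) - poly B z * cnj (poly E w)"
  shows "(poly a z * cnj (poly c z) - poly b z * cnj (poly d z))\<^sup>2 *
      (kernel11 n f z z * kernel n f z z - complex_of_real ((cmod (kernel01 n f z z))\<^sup>2)) =
      poly (wronskian A B) z * cnj (poly (wronskian E C) z) -
      (kernel n f z z)\<^sup>2 * (poly (wronskian a b) z * cnj (poly (wronskian d c) z))"
proof -
  have cnj_factor: "(poly a x * poly (map_poly cnj c) y - poly b x * poly (map_poly cnj d) y) *
      (\<Sum>j\<le>n. poly (f j) x * poly (map_poly cnj (f j)) y) =
      poly A x * poly (map_poly cnj C) y - poly B x * poly (map_poly cnj E) y" for x y
    using assms[of x "cnj y"] by (simp add: kernel_def)
  \<comment> \<open>On the diagonal K_x is the conjugate of K_y = \<open>kernel01\<close>, so the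
    squared modulus is the product K_x K_y.\<close>
  have "complex_of_real ((cmod (kernel01 n f z z))\<^sup>2) = cnj (kernel01 n f z z) * kernel01 n f z z"
    by (simp add: complex_norm_square mult.commute del: of_real_power)
  then have "kernel11 n f z z * kernel n f z z - complex_of_real ((cmod (kernel01 n f z z))\<^sup>2) =
      (\<Sum>j\<le>n. poly (f j) z * cnj (poly (f j) z)) *
        (\<Sum>j\<le>n. poly (pderiv (f j)) z * cnj (poly (pderiv (f j)) z)) -
      (\<Sum>j\<le>n. poly (pderiv (f j)) z * cnj (poly (f j) z)) *
        (\<Sum>j\<le>n. poly (f j) z * cnj (poly (pderiv (f j)) z))"
    by (simp add: kernel_def kernel01_def kernel11_def mult.commute)
  then show ?thesis
    using wronskian_of_factorization[of a "map_poly cnj c" b "map_poly cnj d" f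
        "\<lambda>j. map_poly cnj (f j)" "{..n}" A "map_poly cnj C" B "map_poly cnj E" z "cnj z",
        OF cnj_factor]
    by (simp add: pderiv_map_poly_cnj kernel_def wronskian_def)
qed

text \<open>The quotient of Wronskian and kernel will turn out to be |k_n|; unlike k_n it has no
  poles.\<close>

lemma intensity_circle:
  assumes kernel: "\<And>z w. (1 - z * cnj w) * kernel n f z w =
      poly A z * cnj (poly A w) - poly B z * cnj (poly B w)"
    and "degree (f 0) = 0" "f 0 \<noteq> 0" "cmod z \<noteq> 1"
  shows "intensity n f z = complex_of_real
    ((1 - (cmod (poly (wronskian B A) z) / cmod (kernel n f z z))\<^sup>2) / (pi * (1 - (cmod z)\<^sup>2)\<^sup>2))"
proof -
  obtain k where k: "k > 0" "kernel n f z z = complex_of_real k"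
    using kernel_diag assms(2,3) by metis
  let ?W = "poly (wronskian B A) z" and ?D = "1 - (cmod z)\<^sup>2"
  have W: "poly (wronskian A B) z = - ?W"
    by (simp add: wronskian_def)
  have D: "1 - z * cnj z = complex_of_real ?D"
    by (simp flip: complex_norm_square)
  have "?D \<noteq> 0"
    using assms(4) norm_ge_zero[of z] unfolding right_minus_eq
    by (metis less_le_not_le neg_0_le_iff_le not_one_le_zero power2_eq_1_iff)
  have "(1 - z * cnj z)\<^sup>2 *
      (kernel11 n f z z * kernel n f z z - complex_of_real ((cmod (kernel01 n f z z))\<^sup>2)) =
      - (?W * cnj ?W) + (complex_of_real k)\<^sup>2"
    \<comment> \<open>Here D = 1 - xy, whose Wronskians are W(1,x) = -1 and W(y,1) = 1; this yields
      the term + k^2.\<close>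
    using wronskian_of_kernel[of 1 1 "[:0, 1:]" "[:0, 1:]" n f A A B B z] kernel
    by (simp add: W k(2)) (simp add: wronskian_def pderiv_pCons)
  also have "\<dots> = complex_of_real (k\<^sup>2 - (cmod ?W)\<^sup>2)"
    by (simp flip: complex_norm_square)
  finally have "complex_of_real (?D\<^sup>2) *
      (kernel11 n f z z * kernel n f z z - complex_of_real ((cmod (kernel01 n f z z))\<^sup>2)) =
      complex_of_real (k\<^sup>2 - (cmod ?W)\<^sup>2)"
    unfolding D by simp
  then have num: "kernel11 n f z z * kernel n f z z - complex_of_real ((cmod (kernel01 n f z z))\<^sup>2) =
      complex_of_real ((k\<^sup>2 - (cmod ?W)\<^sup>2) / ?D\<^sup>2)"
    using \<open>?D \<noteq> 0\<close> by (intro eq_of_real_divideI) simp_all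
  have "intensity n f z = complex_of_real ((k\<^sup>2 - (cmod ?W)\<^sup>2) / ?D\<^sup>2 / (pi * k\<^sup>2))"
    unfolding intensity_def num by (simp add: k(2))
  also have "(k\<^sup>2 - (cmod ?W)\<^sup>2) / ?D\<^sup>2 / (pi * k\<^sup>2) = (1 - (cmod ?W / k)\<^sup>2) / (pi * ?D\<^sup>2)"
    using k(1) by (simp add: power_divide diff_divide_distrib mult_ac)
  finally show ?thesis
    using k by simp
qed

lemma intensity_line:
  assumes kernel: "\<And>z w. (z - cnj w) * kernel n f z w = complex_of_real c *
      (poly A z * cnj (poly B w) - poly B z * cnj (poly A w))"
    and "degree (f 0) = 0" "f 0 \<noteq> 0" "Im z \<noteq> 0"
  shows "intensity n f z = complex_of_real
    ((1 - (c * cmod (poly (wronskian A B) z) / cmod (kernel n f z z))\<^sup>2) / (4 * pi * (Im z)\<^sup>2))"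
proof -
  obtain k where k: "k > 0" "kernel n f z z = complex_of_real k"
    using kernel_diag assms(2,3) by metis
  let ?W = "poly (wronskian A B) z"
  have W: "poly (wronskian (smult (complex_of_real c) A) (smult (complex_of_real c) B)) z =
      (complex_of_real c)\<^sup>2 * ?W"
    by (simp add: wronskian_def pderiv_smult power2_eq_square algebra_simps)
  \<comment> \<open>As z - \<open>cnj z\<close> = 2 i Im z, its square is negative: the source of
    the 4 and of the sign change below.\<close>
  have D: "(z - cnj z)\<^sup>2 = complex_of_real (- 4 * (Im z)\<^sup>2)"
    by (simp add: complex_diff_cnj power_mult_distrib)
  have "(z - cnj z)\<^sup>2 *
      (kernel11 n f z z * kernel n f z z - complex_of_real ((cmod (kernel01 n f z z))\<^sup>2)) =
      (complex_of_real c)\<^sup>2 * (?W * cnj ?W) - (complex_of_real k)\<^sup>2"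
    \<comment> \<open>Here D = x - y has Wronskian product 1. The constant \<open>c\<close> is
      absorbed into both left factors and comes out squared.\<close>
    using wronskian_of_kernel[of "[:0, 1:]" 1 1 "[:0, 1:]" n f "smult (complex_of_real c) A" B
        "smult (complex_of_real c) B" A z] kernel
    by (simp add: W k(2) mult_ac right_diff_distrib) (simp add: wronskian_def pderiv_pCons mult_ac)
  also have "\<dots> = complex_of_real (c\<^sup>2 * (cmod ?W)\<^sup>2 - k\<^sup>2)"
    by (simp flip: complex_norm_square)
  finally have num: "kernel11 n f z z * kernel n f z z - complex_of_real ((cmod (kernel01 n f z z))\<^sup>2) =
      complex_of_real ((c\<^sup>2 * (cmod ?W)\<^sup>2 - k\<^sup>2) / (- 4 * (Im z)\<^sup>2))"
    unfolding D using \<open>Im z \<noteq> 0\<close> by (intro eq_of_real_divideI) simp_all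
  have "intensity n f z = complex_of_real ((c\<^sup>2 * (cmod ?W)\<^sup>2 - k\<^sup>2) / (- 4 * (Im z)\<^sup>2) / (pi * k\<^sup>2))"
    unfolding intensity_def num by (simp add: k(2))
  also have "(c\<^sup>2 * (cmod ?W)\<^sup>2 - k\<^sup>2) / (- 4 * (Im z)\<^sup>2) / (pi * k\<^sup>2) =
      (1 - (c * cmod ?W / k)\<^sup>2) / (4 * pi * (Im z)\<^sup>2)"
    using k(1) assms(4) by (simp add: field_simps)
  finally show ?thesis
    using k by simp
qed

subsection \<open>Christoffel--Darboux formulas\<close>

text \<open>Linearity in the first argument is shared by the real bilinear and the complex
  sesquilinear form, so one expansion serves both.\<close>

locale orthonormal_polys =
  fixes ip :: "'a :: field poly \<Rightarrow> 'a poly \<Rightarrow> 'a" and \<phi> :: "nat \<Rightarrow> 'a poly"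
  assumes ip_add_left: "ip (p + q) r = ip p r + ip q r"
    and ip_smult_left: "ip (smult c p) r = c * ip p r"
    and degree_phi [simp]: "degree (\<phi> j) = j"
    and phi_nonzero [simp]: "\<phi> j \<noteq> 0"
    and orthonormal: "ip (\<phi> m) (\<phi> k) = (if m = k then 1 else 0)"
begin

lemma ip_0_left [simp]: "ip 0 r = 0"
  using ip_smult_left[of 0 0 r] by simp

lemma ip_diff_left: "ip (p - q) r = ip p r - ip q r"
  using ip_add_left[of "p - q" q r] by simp

lemma ip_sum_left: "ip (sum f A) r = (\<Sum>x\<in>A. ip (f x) r)"
  by (induction A rule: infinite_finite_induct) (simp_all add: ip_add_left)

text \<open>Stating the degree bound by vanishing coefficients lets \<open>m = 0\<close> mean
  \<open>q = 0\<close>. The induction removes the coefficient at \<open>m\<close> with a multiple of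
  \<open>\<phi> m\<close>.\<close>

lemma ex_expansion: "\<forall>k\<ge>m. coeff q k = 0 \<Longrightarrow> \<exists>c. q = (\<Sum>j<m. smult (c j) (\<phi> j))"
proof (induction m arbitrary: q)
  case 0
  then show ?case by (simp add: poly_eq_iff)
next
  case (Suc m)
  define b where "b = coeff q m / lead_coeff (\<phi> m)"
  have lead: "coeff (\<phi> m) m \<noteq> 0"
    using phi_nonzero[of m] leading_coeff_0_iff[of "\<phi> m"] by simp
  have "coeff (q - smult b (\<phi> m)) k = 0" if "k \<ge> m" for k
  proof (cases "k = m")
    case True
    then show ?thesis using lead by (simp add: b_def)
  next
    case False
    then show ?thesis using that Suc.prems by (simp add: coeff_eq_0)
  qed
  then obtain c where c: "q - smult b (\<phi> m) = (\<Sum>j<m. smult (c j) (\<phi> j))"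
    using Suc.IH by blast
  have "q = (\<Sum>j<Suc m. smult ((c(m := b)) j) (\<phi> j))"
    using c by (simp add: algebra_simps)
  then show ?case by blast
qed

lemma fourier_expansion:
  assumes "\<forall>k\<ge>m. coeff q k = 0"
  shows "q = (\<Sum>j<m. smult (ip q (\<phi> j)) (\<phi> j))"
proof -
  obtain c where c: "q = (\<Sum>j<m. smult (c j) (\<phi> j))"
    using ex_expansion[OF assms] by blast
  have "ip q (\<phi> k) = c k" if "k < m" for k
  proof -
    have "ip q (\<phi> k) = (\<Sum>j<m. if j = k then c j else 0)"
      by (subst c) (simp add: ip_sum_left ip_smult_left orthonormal if_distrib cong: if_cong)
    with that show ?thesis by simp
  qed
  then show ?thesis by (subst c) (auto intro!: sum.cong)
qed

lemma eq_0_if_orthogonal: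
  assumes "\<forall>k\<ge>m. coeff q k = 0" and "\<And>j. j < m \<Longrightarrow> ip q (\<phi> j) = 0"
  shows "q = 0"
  using fourier_expansion[OF assms(1)] assms(2) by simp

lemma low_degree_orthogonal:
  assumes "\<forall>k\<ge>n. coeff q k = 0"
  shows "ip q (\<phi> n) = 0"
  by (subst fourier_expansion[OF assms]) (simp add: ip_sum_left ip_smult_left orthonormal)

end

section \<open>Real line: Jacobi recurrence\<close>

text \<open>\<open>ip_shift\<close> says that multiplication by x is self-adjoint.\<close>

locale real_line_polys = orthonormal_polys +
  assumes ip_commute: "ip p q = ip q p"
    and ip_shift: "ip (pCons 0 p) q = ip p (pCons 0 q)"
begin

text \<open>The off-diagonal entry of the Jacobi matrix.\<close>

definition jacobi :: "nat \<Rightarrow> 'a" where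
  "jacobi n = ip (pCons 0 (\<phi> n)) (\<phi> (Suc n))"

lemma three_term_0:
  "pCons 0 (\<phi> 0) = smult (jacobi 0) (\<phi> 1) + smult (ip (pCons 0 (\<phi> 0)) (\<phi> 0)) (\<phi> 0)"
proof -
  have "\<forall>k\<ge>2. coeff (pCons 0 (\<phi> 0)) k = 0"
    by (auto simp: coeff_pCons coeff_eq_0 split: nat.split)
  from fourier_expansion[OF this] show ?thesis
    by (simp add: numeral_2_eq_2 jacobi_def add.commute)
qed

text \<open>In the Fourier coefficient at \<open>j < n\<close>, self-adjointness moves x onto
  \<open>\<phi> j\<close>, leaving degree at most n against \<open>\<phi> (Suc n)\<close>, hence 0.
  The same move at \<open>j = n\<close> gives \<open>jacobi n\<close>.\<close>

lemma three_term_Suc: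
  "pCons 0 (\<phi> (Suc n)) = smult (jacobi (Suc n)) (\<phi> (Suc (Suc n))) +
     smult (ip (pCons 0 (\<phi> (Suc n))) (\<phi> (Suc n))) (\<phi> (Suc n)) + smult (jacobi n) (\<phi> n)"
proof -
  have "\<forall>k\<ge>Suc (Suc (Suc n)). coeff (pCons 0 (\<phi> (Suc n))) k = 0"
    by (auto simp: coeff_pCons coeff_eq_0 split: nat.split)
  note fourier_expansion[OF this]
  also have "(\<Sum>j<Suc (Suc (Suc n)). smult (ip (pCons 0 (\<phi> (Suc n))) (\<phi> j)) (\<phi> j)) =
      (\<Sum>j<n. smult (ip (pCons 0 (\<phi> (Suc n))) (\<phi> j)) (\<phi> j)) + smult (jacobi n) (\<phi> n) +
      smult (ip (pCons 0 (\<phi> (Suc n))) (\<phi> (Suc n))) (\<phi> (Suc n)) +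
      smult (jacobi (Suc n)) (\<phi> (Suc (Suc n)))"
    using ip_shift[of "\<phi> n" "\<phi> (Suc n)"] ip_commute[of "\<phi> n" "pCons 0 (\<phi> (Suc n))"]
    by (simp add: jacobi_def)
  also have "(\<Sum>j<n. smult (ip (pCons 0 (\<phi> (Suc n))) (\<phi> j)) (\<phi> j)) = 0"
  proof (intro sum.neutral ballI)
    fix j assume "j \<in> {..<n}"
    then have "\<forall>k\<ge>Suc n. coeff (pCons 0 (\<phi> j)) k = 0"
      by (auto simp: coeff_pCons coeff_eq_0 split: nat.split)
    then show "smult (ip (pCons 0 (\<phi> (Suc n))) (\<phi> j)) (\<phi> j) = 0"
      using low_degree_orthogonal[of "Suc n" "pCons 0 (\<phi> j)"]
        ip_shift[of "\<phi> (Suc n)" "\<phi> j"] ip_commute[of "\<phi> (Suc n)" "pCons 0 (\<phi> j)"] by simp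
  qed
  finally show ?thesis by (simp add: algebra_simps)
qed

text \<open>The homomorphism \<open>h\<close> carries the identity from the coefficient field to a
  larger ring; it is used to evaluate real polynomials at complex points.\<close>

lemma christoffel_darboux:
  fixes h :: "'a \<Rightarrow> 'b :: comm_ring_1"
  assumes "\<And>x y. h (x + y) = h x + h y" "\<And>x y. h (x * y) = h x * h y" "h 0 = 0"
  shows "(x - y) * (\<Sum>j\<le>n. poly (map_poly h (\<phi> j)) x * poly (map_poly h (\<phi> j)) y) =
    h (jacobi n) * (poly (map_poly h (\<phi> (Suc n))) x * poly (map_poly h (\<phi> n)) y -
      poly (map_poly h (\<phi> n)) x * poly (map_poly h (\<phi> (Suc n))) y)"
proof -
  let ?P = "\<lambda>j z. poly (map_poly h (\<phi> j)) z"
  have hom_smult: "map_poly h (smult c p) = smult (h c) (map_poly h p)" for c p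
    using assms by (intro poly_eqI) (simp add: coeff_map_poly)
  have hom_add: "map_poly h (p + q) = map_poly h p + map_poly h q" for p q
    using assms by (intro poly_eqI) (simp add: coeff_map_poly)
  have hom_pCons: "map_poly h (pCons 0 p) = pCons 0 (map_poly h p)" for p
    using assms by (intro poly_eqI) (simp add: coeff_map_poly coeff_pCons split: nat.split)
  note hom = hom_smult hom_add hom_pCons
  show ?thesis
  proof (induction n)
    case 0
    define b where "b = h (ip (pCons 0 (\<phi> 0)) (\<phi> 0))"
    have r: "z * ?P 0 z = h (jacobi 0) * ?P 1 z + b * ?P 0 z" for z
      using arg_cong[OF three_term_0, of "\<lambda>p. poly (map_poly h p) z"] by (simp add: hom b_def)
    have "(x - y) * (?P 0 x * ?P 0 y) = (x * ?P 0 x) * ?P 0 y - ?P 0 x * (y * ?P 0 y)"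
      by (simp add: algebra_simps)
    also have "\<dots> = h (jacobi 0) * (?P 1 x * ?P 0 y - ?P 0 x * ?P 1 y)"
      unfolding r by (simp add: algebra_simps)
    finally show ?case by simp
  next
    case (Suc n)
    define b where "b = h (ip (pCons 0 (\<phi> (Suc n))) (\<phi> (Suc n)))"
    have r: "z * ?P (Suc n) z = h (jacobi (Suc n)) * ?P (Suc (Suc n)) z + b * ?P (Suc n) z +
        h (jacobi n) * ?P n z" for z
      using arg_cong[OF three_term_Suc, of "\<lambda>p. poly (map_poly h p) z"] by (simp add: hom b_def)
    have "(x - y) * (\<Sum>j\<le>Suc n. ?P j x * ?P j y) = (x - y) * (\<Sum>j\<le>n. ?P j x * ?P j y) +
        ((x * ?P (Suc n) x) * ?P (Suc n) y - ?P (Suc n) x * (y * ?P (Suc n) y))"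
      by (simp add: algebra_simps)
    \<comment> \<open>After inserting the recurrence, the \<open>b\<close> terms cancel by symmetry
      and the \<open>jacobi n\<close> terms cancel the induction hypothesis.\<close>
    also have "\<dots> = h (jacobi (Suc n)) *
        (?P (Suc (Suc n)) x * ?P (Suc n) y - ?P (Suc n) x * ?P (Suc (Suc n)) y)"
      unfolding r Suc.IH by (simp add: algebra_simps)
    finally show ?case .
  qed
qed

end

section \<open>Unit circle: Szego recursion\<close>

text \<open>The assumptions on \<open>ip\<close> abstract |z| = 1: multiplication by z is an
  isometry, and on the circle \<open>star_poly p\<close> is z^(degree p) times the conjugate of
  \<open>p\<close>.\<close>

locale unit_circle_polys = orthonormal_polys ip \<phi>
  for ip :: "complex poly \<Rightarrow> complex poly \<Rightarrow> complex" and \<phi> :: "nat \<Rightarrow> complex poly" +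
  fixes \<kappa> :: "nat \<Rightarrow> real"
  assumes ip_cnj: "ip q p = cnj (ip p q)"
    and ip_shift: "ip (pCons 0 p) (pCons 0 q) = ip p q"
    and ip_star_star: "ip (star_poly p) (star_poly p) = ip p p"
    and ip_star_monom: "k \<le> degree p \<Longrightarrow>
      ip (star_poly p) (monom 1 k) = ip (monom 1 (degree p - k)) p"
    and lead_coeff_phi: "lead_coeff (\<phi> j) = complex_of_real (\<kappa> j)"
    and kappa_pos: "\<kappa> j > 0"
begin

lemma ip_add_right: "ip r (p + q) = ip r p + ip r q"
  by (subst (1 2 3) ip_cnj) (simp add: ip_add_left)

lemma ip_smult_right: "ip r (smult c p) = cnj c * ip r p"
  by (subst (1 2) ip_cnj) (simp add: ip_smult_left)

lemma ip_sum_right: "ip r (sum f A) = (\<Sum>x\<in>A. ip r (f x))"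
  by (induction A rule: infinite_finite_induct)
    (use ip_smult_right[of r 0 0] in \<open>simp_all add: ip_add_right\<close>)

lemma coeff_phi_self: "coeff (\<phi> n) n = complex_of_real (\<kappa> n)"
  using lead_coeff_phi[of n] by simp

text \<open>Reversal turns the pairing with z^(i+1) into that of z^(n-i-1) with
  \<open>\<phi> n\<close>, which vanishes by degree.\<close>

lemma star_orthogonal:
  assumes "\<forall>k\<ge>n. coeff q k = 0"
  shows "ip (star_poly (\<phi> n)) (pCons 0 q) = 0"
proof -
  have "pCons 0 q = (\<Sum>i<n. smult (coeff q i) (monom 1 (Suc i)))"
  proof (rule poly_eqI)
    fix k
    show "coeff (pCons 0 q) k = coeff (\<Sum>i<n. smult (coeff q i) (monom 1 (Suc i))) k"
      using assms
      by (cases k) (auto simp: coeff_sum coeff_pCons if_distrib sum.delta' not_less cong: if_cong)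
  qed
  moreover have "ip (star_poly (\<phi> n)) (monom 1 (Suc i)) = 0" if "i < n" for i
    using that by (auto simp: ip_star_monom coeff_monom intro!: low_degree_orthogonal)
  ultimately show ?thesis
    by (simp add: ip_sum_right ip_smult_right)
qed

lemma coeff_star_0: "coeff (star_poly (\<phi> n)) 0 = complex_of_real (\<kappa> n)"
  by (simp add: star_poly_def degree_map_poly coeff_map_poly coeff_phi_self)

lemma coeff_star_above: "k > n \<Longrightarrow> coeff (star_poly (\<phi> n)) k = 0"
  by (simp add: star_poly_def coeff_reflect_poly degree_map_poly)

text \<open>
  Polynomials of degree at most $n$ orthogonal to $z, \dots, z^n$ are multiples of $\varphi_n^*$:
  subtracting the multiple with the same constant term leaves some $z R$ with $R$ of degree below
  $n$ and orthogonal to all such polynomials.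
\<close>

lemma szego_recursion_ex:
  "\<exists>c. smult (complex_of_real (\<kappa> n / \<kappa> (Suc n))) (\<phi> (Suc n)) =
    pCons 0 (\<phi> n) + smult c (star_poly (\<phi> n))"
proof -
  \<comment> \<open>This ratio makes the two terms of \<open>Q\<close> agree at degree n + 1, so
    that \<open>Q\<close> has degree at most n.\<close>
  define r where "r = complex_of_real (\<kappa> n / \<kappa> (Suc n))"
  define Q where "Q = smult r (\<phi> (Suc n)) - pCons 0 (\<phi> n)"
  define c where "c = coeff Q 0 / complex_of_real (\<kappa> n)"
  obtain R where R: "Q - smult c (star_poly (\<phi> n)) = pCons 0 R"
  proof -
    have "coeff (Q - smult c (star_poly (\<phi> n))) 0 = 0"
      using kappa_pos[of n] by (simp add: c_def coeff_star_0)
    then show ?thesis using that by (metis pCons_cases coeff_pCons_0)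
  qed
  have R_coeff: "\<forall>k\<ge>n. coeff R k = 0"
  proof (intro allI impI)
    fix k assume "k \<ge> n"
    have "coeff R k = coeff (Q - smult c (star_poly (\<phi> n))) (Suc k)"
      by (simp add: R)
    also have "\<dots> = 0"
      using \<open>k \<ge> n\<close> kappa_pos[of "Suc n"] kappa_pos[of n]
      by (cases "k = n")
        (auto simp: Q_def coeff_star_above coeff_phi_self r_def coeff_eq_0)
    finally show "coeff R k = 0" .
  qed
  have "R = 0"
  proof (rule eq_0_if_orthogonal[OF R_coeff])
    fix j assume "j < n"
    then have j: "\<forall>k\<ge>n. coeff (\<phi> j) k = 0" "\<forall>k\<ge>Suc n. coeff (pCons 0 (\<phi> j)) k = 0"
      by (auto simp: coeff_pCons coeff_eq_0 split: nat.split)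
    have "ip R (\<phi> j) = ip (pCons 0 R) (pCons 0 (\<phi> j))"
      by (simp add: ip_shift)
    also have "\<dots> = r * ip (\<phi> (Suc n)) (pCons 0 (\<phi> j)) - ip (\<phi> n) (\<phi> j)
        - c * ip (star_poly (\<phi> n)) (pCons 0 (\<phi> j))"
      by (simp add: R[symmetric] Q_def ip_diff_left ip_smult_left ip_shift)
    also have "\<dots> = 0"
      using star_orthogonal[OF j(1)] low_degree_orthogonal[OF j(2)] \<open>j < n\<close>
        ip_cnj[of "\<phi> (Suc n)" "pCons 0 (\<phi> j)"]
      by (simp add: orthonormal)
    finally show "ip R (\<phi> j) = 0" .
  qed
  then show ?thesis
    using R unfolding Q_def r_def by (intro exI[of _ c]) (simp add: algebra_simps)
qed

text \<open>Up to sign and conjugation \<open>c\<close> is the Verblunsky coefficient. The relation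
  between \<open>r\<close> and \<open>c\<close> compares squared norms of both sides, where z
  \<open>\<phi> n\<close> and its companion \<open>star_poly (\<phi> n)\<close> have norm 1.\<close>

lemma szego_recursion:
  obtains c r where "r \<noteq> 0" "complex_of_real (r\<^sup>2) = 1 - c * cnj c"
    "smult (complex_of_real r) (\<phi> (Suc n)) = pCons 0 (\<phi> n) + smult c (star_poly (\<phi> n))"
proof -
  define r where "r = \<kappa> n / \<kappa> (Suc n)"
  obtain c where c: "smult (complex_of_real r) (\<phi> (Suc n)) =
      pCons 0 (\<phi> n) + smult c (star_poly (\<phi> n))"
    using szego_recursion_ex[of n] by (auto simp: r_def)
  let ?z = "pCons 0 (\<phi> n)" and ?s = "star_poly (\<phi> n)"
  have s: "ip ?s (\<phi> (Suc n)) = 0"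
    by (auto intro: low_degree_orthogonal simp: coeff_star_above)
  have norms: "ip ?s ?s = 1" "ip ?z ?z = 1"
    by (simp_all add: ip_star_star ip_shift orthonormal)
  \<comment> \<open>The reversed polynomial has degree at most n, hence is orthogonal to
    \<open>\<phi> (Suc n)\<close>; this determines its pairing with z
    \<open>\<phi> n\<close>.\<close>
  have "ip ?s ?z + cnj c = ip ?s (?z + smult c ?s)"
    by (simp add: ip_add_right ip_smult_right norms)
  also have "\<dots> = 0"
    unfolding c[symmetric] by (simp add: ip_smult_right s)
  finally have sz: "ip ?s ?z = - cnj c"
    by (simp add: eq_neg_iff_add_eq_0)
  then have zs: "ip ?z ?s = - c"
    by (subst ip_cnj) simp
  have "complex_of_real (r\<^sup>2) =
      ip (smult (complex_of_real r) (\<phi> (Suc n))) (smult (complex_of_real r) (\<phi> (Suc n)))"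
    by (simp add: ip_smult_left ip_smult_right orthonormal power2_eq_square)
  also have "\<dots> = 1 - c * cnj c"
    unfolding c by (simp add: ip_add_left ip_add_right ip_smult_left ip_smult_right norms zs sz)
  finally show ?thesis
    using that[of r c] c kappa_pos[of n] kappa_pos[of "Suc n"] by (simp add: r_def)
qed

text \<open>The recursion and its reversal map the pair (z \<open>\<phi> n\<close>, its reversed
  companion) by a matrix that preserves the indefinite form |s|^2 - |p|^2 up to the factor 1 - |c|^2
  = r^2.\<close>

lemma szego_step:
  defines "s \<equiv> \<lambda>n. poly (star_poly (\<phi> n))"
  shows "s (Suc n) x * cnj (s (Suc n) w) - poly (\<phi> (Suc n)) x * cnj (poly (\<phi> (Suc n)) w) =
    s n x * cnj (s n w) - x * cnj w * (poly (\<phi> n) x * cnj (poly (\<phi> n) w))"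
proof -
  obtain c r where r: "r \<noteq> 0" "complex_of_real (r\<^sup>2) = 1 - c * cnj c"
    and rec: "smult (complex_of_real r) (\<phi> (Suc n)) = pCons 0 (\<phi> n) + smult c (star_poly (\<phi> n))"
    by (rule szego_recursion)
  have 1: "complex_of_real r * poly (\<phi> (Suc n)) z = z * poly (\<phi> n) z + c * s n z" for z
    using arg_cong[OF rec, of "\<lambda>p. poly p z"] by (simp add: s_def)
  have 2: "complex_of_real r * s (Suc n) z = s n z + cnj c * z * poly (\<phi> n) z" for z
  proof (cases "z = 0")
    case True
    have "complex_of_real r * coeff (\<phi> (Suc n)) (Suc n) = coeff (\<phi> n) n"
      using arg_cong[OF rec, of "\<lambda>p. coeff p (Suc n)"] by (simp add: coeff_star_above)
    then show ?thesis
      using True by (simp add: s_def poly_0_coeff_0 coeff_star_0 coeff_phi_self)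
  next
    case False
    define u where "u = 1 / cnj z"
    have u: "u \<noteq> 0" "cnj u = 1 / z" "1 / cnj u = z"
      using False by (simp_all add: u_def)
    have "complex_of_real r * s (Suc n) z = z ^ Suc n * cnj (complex_of_real r * poly (\<phi> (Suc n)) u)"
      unfolding s_def using False by (simp add: poly_star_poly[of _ "Suc n"] u_def)
    also have "\<dots> = z ^ n * cnj (poly (\<phi> n) u) + cnj c * z * (z ^ n * cnj (s n u))"
      unfolding 1 using False by (simp add: u algebra_simps)
    also have "z ^ n * cnj (poly (\<phi> n) u) = s n z"
      unfolding s_def using False by (simp add: poly_star_poly[of _ n] u_def)
    also have "z ^ n * cnj (s n u) = poly (\<phi> n) z"
      unfolding s_def using False u by (simp add: poly_star_poly[of _ n] power_divide)
    finally show ?thesis .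
  qed
  have "complex_of_real (r\<^sup>2) *
      (s (Suc n) x * cnj (s (Suc n) w) - poly (\<phi> (Suc n)) x * cnj (poly (\<phi> (Suc n)) w)) =
      (complex_of_real r * s (Suc n) x) * cnj (complex_of_real r * s (Suc n) w) -
      (complex_of_real r * poly (\<phi> (Suc n)) x) * cnj (complex_of_real r * poly (\<phi> (Suc n)) w)"
    by (simp add: power2_eq_square algebra_simps)
  also have "\<dots> = (1 - c * cnj c) *
      (s n x * cnj (s n w) - x * cnj w * (poly (\<phi> n) x * cnj (poly (\<phi> n) w)))"
    unfolding 1 2 by (simp add: algebra_simps)
  finally show ?thesis
    using r by (metis mult_left_cancel of_real_eq_0_iff power_not_zero)
qed

text \<open>Adding the term n + 1 to the induction hypothesis produces the right side of
  \<open>szego_step\<close>. The base case uses that the real constant \<open>\<phi> 0\<close> is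
  its own reversal.\<close>

lemma christoffel_darboux:
  "(1 - x * cnj w) * (\<Sum>j\<le>n. poly (\<phi> j) x * cnj (poly (\<phi> j) w)) =
    poly (star_poly (\<phi> (Suc n))) x * cnj (poly (star_poly (\<phi> (Suc n))) w) -
    poly (\<phi> (Suc n)) x * cnj (poly (\<phi> (Suc n)) w)"
proof (induction n)
  case 0
  have 1: "\<phi> 0 = [:complex_of_real (\<kappa> 0):]"
    using degree_phi[of 0] coeff_phi_self[of 0] by (metis degree_eq_zeroE coeff_pCons_0)
  then have "star_poly (\<phi> 0) = [:complex_of_real (\<kappa> 0):]"
    by (simp add: star_poly_def map_poly_pCons)
  then show ?case
    unfolding szego_step using 1 by (simp add: algebra_simps)
next
  case (Suc n)
  show ?case
    unfolding szego_step[of "Suc n"] sum.atMost_Suc distrib_left Suc.IH by (simp add: algebra_simps)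
qed

end

subsection \<open>Orthonormal polynomials of a measure\<close>

lemma oprl_real_line_polys:
  assumes "oprl \<mu> p"
  shows "real_line_polys (\<lambda>p q. LINT x|\<mu>. poly p x * poly q x) p"
proof -
  have int: "integrable \<mu> (\<lambda>x. poly q x * poly r x)" for q r :: "real poly"
  proof -
    have "integrable \<mu> (\<lambda>x. poly (q * r) x)"
      unfolding poly_altdef using assms by (auto simp: oprl_def)
    then show ?thesis by simp
  qed
  show ?thesis
  proof
    fix j
    show "p j \<noteq> 0" "degree (p j) = j"
      using assms by (auto simp: oprl_def) (metis coeff_0 less_irrefl)
  next
    fix q r s :: "real poly"
    show "(LINT x|\<mu>. poly (q + r) x * poly s x) = (LINT x|\<mu>. poly q x * poly s x) + (LINT x|\<mu>. poly r x * poly s x)"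
      using int by (simp add: distrib_right)
    show "(LINT x|\<mu>. poly (pCons 0 q) x * poly r x) = (LINT x|\<mu>. poly q x * poly (pCons 0 r) x)"
      by (simp add: mult_ac)
  qed (use assms in \<open>auto simp: oprl_def mult_ac\<close>)
qed

lemma opuc_unit_circle_polys:
  assumes "opuc \<mu> \<phi>"
  shows "unit_circle_polys (\<lambda>p q. LINT z|\<mu>. poly p z * cnj (poly q z)) \<phi> (\<lambda>j. Re (lead_coeff (\<phi> j)))"
proof -
  from assms interpret prob_space \<mu> by (simp add: opuc_def)
  have sets [measurable_cong]: "sets \<mu> = sets borel" and circle: "AE z in \<mu>. cmod z = 1"
    using assms by (auto simp: opuc_def)
  have borel: "f \<in> borel_measurable \<mu>" if "continuous_on UNIV f" for f :: "complex \<Rightarrow> complex"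
    using borel_measurable_continuous_onI[OF that] by (simp cong: measurable_cong_sets add: sets)
  have meas [measurable]: "(\<lambda>z. poly q z * cnj (poly r z)) \<in> borel_measurable \<mu>" for q r :: "complex poly"
    by (intro borel continuous_intros)
  \<comment> \<open>Polynomials are unbounded on the plane, but almost everywhere bounded for
    \<open>\<mu>\<close> by compactness of the circle.\<close>
  have int: "integrable \<mu> (\<lambda>z. poly q z * cnj (poly r z))" for q r :: "complex poly"
  proof -
    have "continuous_on (sphere 0 1) (\<lambda>z. poly q z * cnj (poly r z))"
      by (intro continuous_intros)
    then have "bounded ((\<lambda>z. poly q z * cnj (poly r z)) ` sphere 0 1)"
      by (intro compact_imp_bounded compact_continuous_image compact_sphere)
    then obtain B where "\<And>z. z \<in> sphere 0 1 \<Longrightarrow> cmod (poly q z * cnj (poly r z)) \<le> B"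
      unfolding bounded_iff by blast
    then have "AE z in \<mu>. cmod (poly q z * cnj (poly r z)) \<le> B"
      using circle by (auto elim!: eventually_mono simp del: norm_mult)
    then show ?thesis
      by (intro integrable_const_bound[where B = B] meas)
  qed
  \<comment> \<open>Reflection fixes the circle pointwise, which reduces the two reversal axioms to
    pointwise identities.\<close>
  have circle_inverse: "1 / cnj z = z" "z \<noteq> 0" if "cmod z = 1" for z
    using that complex_norm_square[of z] by (auto simp: divide_eq_eq)
  show ?thesis
  proof
    fix j
    show "\<phi> j \<noteq> 0" "degree (\<phi> j) = j" "lead_coeff (\<phi> j) = complex_of_real (Re (lead_coeff (\<phi> j)))"
      "Re (lead_coeff (\<phi> j)) > 0"
      using assms unfolding opuc_def by (metis Re_complex_of_real leading_coeff_0_iff less_irrefl of_real_eq_0_iff)+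
  next
    fix q r s :: "complex poly"
    show "(LINT x|\<mu>. poly (q + r) x * cnj (poly s x)) =
        (LINT x|\<mu>. poly q x * cnj (poly s x)) + (LINT x|\<mu>. poly r x * cnj (poly s x))"
      using int by (simp add: distrib_right)
    show "(LINT z|\<mu>. poly q z * cnj (poly r z)) = cnj (LINT z|\<mu>. poly r z * cnj (poly q z))"
      by (simp add: mult.commute flip: Bochner_Integration.integral_cnj)
    show "(LINT z|\<mu>. poly (pCons 0 q) z * cnj (poly (pCons 0 r) z)) = (LINT z|\<mu>. poly q z * cnj (poly r z))"
    proof (rule integral_cong_AE)
      show "AE z in \<mu>. poly (pCons 0 q) z * cnj (poly (pCons 0 r) z) = poly q z * cnj (poly r z)"
        using circle
      proof eventually_elim
        case (elim z)
        then have "z * cnj z = 1" using complex_norm_square[of z] by simp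
        then have "(z * cnj z) * (poly q z * cnj (poly r z)) = poly q z * cnj (poly r z)"
          by simp
        then show ?case by (simp add: mult_ac)
      qed
    qed (rule meas)+
    show "(LINT z|\<mu>. poly (star_poly q) z * cnj (poly (star_poly q) z)) = (LINT z|\<mu>. poly q z * cnj (poly q z))"
    proof (rule integral_cong_AE)
      show "AE z in \<mu>. poly (star_poly q) z * cnj (poly (star_poly q) z) = poly q z * cnj (poly q z)"
        using circle
      proof eventually_elim
        case (elim z)
        then have "cmod (poly (star_poly q) z) = cmod (poly q z)"
          by (simp add: poly_star_poly[OF refl] circle_inverse norm_mult norm_power)
        then show ?case by (metis complex_norm_square)
      qed
    qed (rule meas)+
    show "(LINT z|\<mu>. poly (star_poly q) z * cnj (poly (monom 1 k) z)) =
        (LINT z|\<mu>. poly (monom 1 (degree q - k)) z * cnj (poly q z))" if "k \<le> degree q" for k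
    proof (rule integral_cong_AE)
      show "AE z in \<mu>. poly (star_poly q) z * cnj (poly (monom 1 k) z) =
          poly (monom 1 (degree q - k)) z * cnj (poly q z)"
        using circle
      proof eventually_elim
        case (elim z)
        then have "z * cnj z = 1" using complex_norm_square[of z] by simp
        then have "z ^ k * cnj z ^ k = 1" by (metis power_mult_distrib power_one)
        moreover have "z ^ degree q = z ^ (degree q - k) * z ^ k"
          using that by (simp flip: power_add)
        ultimately show ?case
          using elim by (simp add: poly_star_poly[OF refl] circle_inverse poly_monom mult_ac)
      qed
    qed (rule meas)+
  qed (use assms in \<open>auto simp: opuc_def mult.assoc\<close>)
qed

subsection \<open>Intensity functions\<close>

text \<open>By \<open>intensity_line\<close> it suffices that h_n equals the Jacobi coefficient
  times |W| / K_n off the real line.\<close>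

lemma oprl_intensity:
  assumes "oprl \<mu> p" and f: "\<And>j. j \<le> n \<Longrightarrow> f j = map_poly complex_of_real (p j)"
  shows "Im z \<noteq> 0 \<Longrightarrow> intensity n f z =
      complex_of_real ((1 - (oprl_h p n z)\<^sup>2) / (4 * pi * (Im z)\<^sup>2))" (is "_ \<Longrightarrow> ?eq z")
    and "((\<lambda>w. complex_of_real ((1 - (oprl_h p n w)\<^sup>2) / (4 * pi * (Im w)\<^sup>2)))
      \<longlongrightarrow> intensity n f z) (at z within - \<real>)"
proof -
  define P where "P = (\<lambda>j. map_poly complex_of_real (p j))"
  interpret real_line_polys "\<lambda>p q. LINT x|\<mu>. poly p x * poly q x" p
    using assms(1) by (rule oprl_real_line_polys)
  have P: "map_poly complex_of_real (p j) = P j" for j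
    by (simp add: P_def)
  let ?A = "P (Suc n)" and ?B = "P n"
  have cnj_P: "cnj (poly (P j) w) = poly (P j) (cnj w)" for j w
    unfolding P_def by (rule poly_cnj_real) (simp add: coeff_map_poly)
  have f0: "degree (f 0) = 0" "f 0 \<noteq> 0"
    using degree_map_poly[of complex_of_real "p 0"] by (simp_all add: f map_poly_eq_0_iff)
  have CD: "(z - cnj w) * kernel n f z w = complex_of_real (jacobi n) *
      (poly ?A z * cnj (poly ?B w) - poly ?B z * cnj (poly ?A w))" for z w
    using christoffel_darboux[of complex_of_real z "cnj w" n]
    by (simp add: kernel_def f P cnj_P)
  show eq: "?eq z" if "Im z \<noteq> 0" for z
  proof -
    obtain k where k: "k > 0" "kernel n f z z = complex_of_real k"
      using kernel_diag[where f = f, OF f0] by metis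
    let ?I = "Im (poly ?A z * cnj (poly ?B z))"
    \<comment> \<open>The diagonal Christoffel--Darboux formula links Im a_n to K_n. It also shows
      that p_n has no nonreal zeros and Im a_n does not vanish there.\<close>
    have "Im ((z - cnj z) * kernel n f z z) = Im (complex_of_real (jacobi n) *
        (poly ?A z * cnj (poly ?B z) - poly ?B z * cnj (poly ?A z)))"
      unfolding CD ..
    then have Im: "Im z * k = jacobi n * ?I"
      by (simp add: k(2) algebra_simps)
    have "jacobi n * ?I \<noteq> 0"
      unfolding Im[symmetric] using that k(1) by simp
    then have nz: "?I \<noteq> 0" "poly ?B z \<noteq> 0"
      by auto
    have "Im (oprl_ratio p n z) = ?I / (cmod (poly ?B z))\<^sup>2"
      by (simp add: oprl_ratio_def P Im_divide cmod_power2 algebra_simps)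
    moreover have "oprl_ratio p n = (\<lambda>z. poly ?A z / poly ?B z)"
      by (simp add: oprl_ratio_def P_def fun_eq_iff)
    then have "cmod (deriv (oprl_ratio p n) z) = cmod (poly (wronskian ?A ?B) z) / (cmod (poly ?B z))\<^sup>2"
      using nz(2) by (simp add: deriv_poly_quotient norm_divide norm_power)
    ultimately have "oprl_h p n z = Im z * cmod (poly (wronskian ?A ?B) z) / ?I"
      using nz unfolding oprl_h_def by simp
    also have "\<dots> = (Im z * k) * cmod (poly (wronskian ?A ?B) z) / (?I * k)"
      using k(1) by simp
    also have "\<dots> = jacobi n * cmod (poly (wronskian ?A ?B) z) / k"
      unfolding Im using nz(1) by simp
    finally show ?thesis
      using intensity_line[OF CD f0 that] k by simp
  qed
  \<comment> \<open>Nonreal points satisfy the formula and the intensity is continuous, so its value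
    is the limit, also at real points.\<close>
  have "eventually (\<lambda>w. intensity n f w =
      complex_of_real ((1 - (oprl_h p n w)\<^sup>2) / (4 * pi * (Im w)\<^sup>2))) (at z within - \<real>)"
    unfolding eventually_at_filter by (intro always_eventually) (simp add: complex_is_Real_iff eq)
  moreover have "(intensity n f \<longlongrightarrow> intensity n f z) (at z within - \<real>)"
    using isCont_intensity[where f = f and z = z, OF f0] unfolding isCont_def by (rule tendsto_mono[OF at_le, rotated]) simp
  ultimately show "((\<lambda>w. complex_of_real ((1 - (oprl_h p n w)\<^sup>2) / (4 * pi * (Im w)\<^sup>2)))
      \<longlongrightarrow> intensity n f z) (at z within - \<real>)"
    by (rule Lim_transform_eventually[rotated])
qed

text \<open>The point is |k_n| = |W| / K_n away from the circle and the zeros of \<open>S\<close>;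
  the right side supplies the extension at those zeros.\<close>

lemma opuc_intensity:
  assumes "opuc \<mu> \<phi>" and f: "\<And>j. j \<le> n \<Longrightarrow> f j = \<phi> j"
  defines "S \<equiv> star_poly (\<phi> (Suc n))"
  shows "poly S z = 0 \<Longrightarrow> cmod z > 1"
    and "cmod z \<noteq> 1 \<Longrightarrow> poly S z \<noteq> 0 \<Longrightarrow> intensity n f z =
      complex_of_real ((1 - (cmod (opuc_k \<phi> n z))\<^sup>2) / (pi * (1 - (cmod z)\<^sup>2)\<^sup>2))"
    and "cmod z \<noteq> 1 \<Longrightarrow> poly S z = 0 \<Longrightarrow>
      \<exists>L. ((\<lambda>w. cmod (opuc_k \<phi> n w)) \<longlongrightarrow> L) (at z) \<and>
        intensity n f z = complex_of_real ((1 - L\<^sup>2) / (pi * (1 - (cmod z)\<^sup>2)\<^sup>2))"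
proof -
  interpret unit_circle_polys "\<lambda>p q. LINT z|\<mu>. poly p z * cnj (poly q z)" \<phi>
      "\<lambda>j. Re (lead_coeff (\<phi> j))"
    using assms(1) by (rule opuc_unit_circle_polys)
  let ?A = "\<phi> (Suc n)"
  have f0: "degree (f 0) = 0" "f 0 \<noteq> 0"
    by (simp_all add: f)
  have CD: "(1 - z * cnj w) * kernel n f z w =
      poly S z * cnj (poly S w) - poly ?A z * cnj (poly ?A w)" for z w
    using christoffel_darboux[of z w n] by (simp add: kernel_def f S_def)
  have kernel_nz: "kernel n f z z \<noteq> 0" for z
    using kernel_diag[of f n z] f0 by (metis less_irrefl of_real_eq_0_iff)
  have CD_diag: "(1 - (cmod z)\<^sup>2) * k = (cmod (poly S z))\<^sup>2 - (cmod (poly ?A z))\<^sup>2"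
    if "kernel n f z z = complex_of_real k" for z k
  proof -
    have "complex_of_real ((1 - (cmod z)\<^sup>2) * k) =
        complex_of_real ((cmod (poly S z))\<^sup>2 - (cmod (poly ?A z))\<^sup>2)"
      using CD[of z z] that by (simp flip: complex_norm_square)
    then show ?thesis
      by (simp only: of_real_eq_iff)
  qed
  show outside: "cmod z > 1" if "poly S z = 0" for z
  proof (rule ccontr)
    assume "\<not> cmod z > 1"
    obtain k where k: "k > 0" "kernel n f z z = complex_of_real k"
      using kernel_diag[where f = f, OF f0] by metis
    have diag: "(1 - (cmod z)\<^sup>2) * k = - (cmod (poly ?A z))\<^sup>2"
      using CD_diag[OF k(2)] that by simp
    moreover have "(cmod z)\<^sup>2 \<le> 1"
      using \<open>\<not> cmod z > 1\<close> by (simp add: power_le_one)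
    then have "(1 - (cmod z)\<^sup>2) * k \<ge> 0"
      using k(1) by simp
    ultimately have "(cmod (poly ?A z))\<^sup>2 \<le> 0"
      by linarith
    then have A0: "poly ?A z = 0"
      by simp
    \<comment> \<open>A zero of \<open>S\<close> in the closed disc would also be a zero of
      \<open>\<phi> (Suc n)\<close>, so (1 - x \<open>cnj z\<close>) K_n(x,z) vanishes for all x. As
      a polynomial in x, \<open>q\<close> = K_n(x,z) is then 0, against K_n(z,z) > 0.\<close>
    define q where "q = (\<Sum>j\<le>n. smult (cnj (poly (f j) z)) (f j))"
    have q: "poly q x = kernel n f x z" for x
      by (simp add: q_def kernel_def poly_sum mult.commute)
    have "poly ([:1, - cnj z:] * q) x = 0" for x
      using CD[of x z] that A0 by (auto simp: q)
    then have "[:1, - cnj z:] * q = 0"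
      using poly_all_0_iff_0 by blast
    then have "q = 0"
      by (metis mult_eq_0_iff pCons_eq_0_iff one_neq_zero)
    then show False
      using q[of z] kernel_nz[of z] by simp
  qed
  have k_eq: "cmod (opuc_k \<phi> n z) = cmod (poly (wronskian ?A S) z) / cmod (kernel n f z z)"
    if "cmod z \<noteq> 1" "poly S z \<noteq> 0" for z
  proof -
    obtain k where k: "k > 0" "kernel n f z z = complex_of_real k"
      using kernel_diag[where f = f, OF f0] by metis
    let ?D = "1 - (cmod z)\<^sup>2" and ?s = "(cmod (poly S z))\<^sup>2"
    have D: "?D \<noteq> 0"
      using that(1) norm_ge_zero[of z] unfolding right_minus_eq
      by (metis less_le_not_le neg_0_le_iff_le not_one_le_zero power2_eq_1_iff)
    have ratio: "opuc_ratio \<phi> n = (\<lambda>z. poly ?A z / poly S z)"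
      by (simp add: opuc_ratio_def S_def fun_eq_iff)
    \<comment> \<open>The diagonal formula replaces 1 - |b_n|^2 by a multiple of K_n; the factors 1
      - |z|^2 and |S|^2 then cancel in |k_n|.\<close>
    have "1 - (cmod (opuc_ratio \<phi> n z))\<^sup>2 = ?D * k / ?s"
      unfolding CD_diag[OF k(2)] using that(2)
      by (simp add: ratio norm_divide power_divide diff_divide_distrib)
    moreover have "deriv (opuc_ratio \<phi> n) z = poly (wronskian ?A S) z / (poly S z)\<^sup>2"
      unfolding ratio using that(2) by (rule deriv_poly_quotient)
    ultimately have "cmod (opuc_k \<phi> n z) =
        \<bar>?D\<bar> * (cmod (poly (wronskian ?A S) z) / ?s) / \<bar>?D * k / ?s\<bar>"
      unfolding opuc_k_def by (simp only: norm_divide norm_mult norm_of_real norm_power)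
    also have "\<dots> = cmod (poly (wronskian ?A S) z) / k"
      using D that(2) k(1) by (simp add: abs_mult)
    finally show ?thesis
      using k by simp
  qed
  note circle = intensity_circle[OF CD f0]
  show "intensity n f z =
      complex_of_real ((1 - (cmod (opuc_k \<phi> n z))\<^sup>2) / (pi * (1 - (cmod z)\<^sup>2)\<^sup>2))"
    if "cmod z \<noteq> 1" "poly S z \<noteq> 0"
    using circle[OF that(1)] k_eq[OF that] by simp
  show "\<exists>L. ((\<lambda>w. cmod (opuc_k \<phi> n w)) \<longlongrightarrow> L) (at z) \<and>
      intensity n f z = complex_of_real ((1 - L\<^sup>2) / (pi * (1 - (cmod z)\<^sup>2)\<^sup>2))"
    if "cmod z \<noteq> 1" "poly S z = 0"
  proof (intro exI conjI)
    \<comment> \<open>The limit is the value of this everywhere continuous quotient.\<close>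
    let ?g = "\<lambda>w. cmod (poly (wronskian ?A S) w) / cmod (kernel n f w w)"
    have "continuous_on UNIV ?g"
      by (intro continuous_intros continuous_kernel) (simp add: kernel_nz)
    then have "?g \<midarrow>z\<rightarrow> ?g z"
      by (simp add: continuous_on_eq_continuous_at isCont_def)
    moreover have "eventually (\<lambda>w. ?g w = cmod (opuc_k \<phi> n w)) (at z)"
    proof -
      \<comment> \<open>\<open>S\<close> has finitely many zeros, and \<open>z\<close> lies outside
        the closed disc, so a punctured neighbourhood avoids both the zeros and the circle.\<close>
      have "S \<noteq> 0"
        by (simp add: S_def star_poly_def map_poly_eq_0_iff)
      then have "finite ({w. poly S w = 0} - {z})"
        by (simp add: poly_roots_finite)
      then have "open (- ({w. poly S w = 0} - {z}))"
        by (intro open_Compl finite_imp_closed)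
      moreover have "open {w. cmod w > 1}"
        by (intro open_Collect_less continuous_intros)
      ultimately have "open (- ({w. poly S w = 0} - {z}) \<inter> {w. cmod w > 1})"
        by (rule open_Int)
      then have "eventually (\<lambda>w. w \<in> - ({w. poly S w = 0} - {z}) \<inter> {w. cmod w > 1}) (nhds z)"
        by (rule eventually_nhds_in_open) (use outside that(2) in auto)
      then show ?thesis
        unfolding eventually_at_filter by eventually_elim (auto simp: k_eq)
    qed
    ultimately show "(\<lambda>w. cmod (opuc_k \<phi> n w)) \<midarrow>z\<rightarrow> ?g z"
      by (rule Lim_transform_eventually)
    show "intensity n f z = complex_of_real ((1 - (?g z)\<^sup>2) / (pi * (1 - (cmod z)\<^sup>2)\<^sup>2))"
      using circle[OF that(1)] .
  qed
qed

text \<open>Continuous extension is expressed by limits: through nonreal points on the line, and as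
  a limit \<open>L\<close> of |k_n| at the poles of b_n.\<close>

theorem theorem1:
  fixes n :: nat
    and M :: "'a measure"
    and \<eta> :: "nat \<Rightarrow> 'a \<Rightarrow> complex"
    and f :: "nat \<Rightarrow> complex poly"
    and P :: "'a \<Rightarrow> complex \<Rightarrow> complex"
  assumes "std_complex_gaussians M {..n} \<eta>"
    and "\<And>\<omega> z. P \<omega> z = (\<Sum>j\<le>n. \<eta> j \<omega> * poly (f j) z)"
  shows "(\<forall>(\<mu> :: real measure) (p :: nat \<Rightarrow> real poly).
           oprl \<mu> p \<and> (\<forall>j\<le>n. f j = map_poly complex_of_real (p j)) \<longrightarrow>
             (\<forall>z. z \<notin> \<real> \<longrightarrow>
               intensity n f z =
                 complex_of_real ((1 - (oprl_h p n z)\<^sup>2) / (4 * pi * (Im z)\<^sup>2))) \<and>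
             (\<forall>z\<in>\<real>.
               ((\<lambda>w. complex_of_real ((1 - (oprl_h p n w)\<^sup>2) / (4 * pi * (Im w)\<^sup>2)))
                 \<longlongrightarrow> intensity n f z) (at z within - \<real>))) \<and>
         (\<forall>(\<mu> :: complex measure) (\<phi> :: nat \<Rightarrow> complex poly).
           opuc \<mu> \<phi> \<and> conjugate_symmetric \<mu> \<and> (\<forall>j\<le>n. f j = \<phi> j) \<longrightarrow>
             (\<forall>z. poly (star_poly (\<phi> (Suc n))) z = 0 \<longrightarrow> cmod z > 1) \<and>
             (\<forall>z. cmod z \<noteq> 1 \<and> poly (star_poly (\<phi> (Suc n))) z \<noteq> 0 \<longrightarrow>
               intensity n f z =
                 complex_of_real ((1 - (cmod (opuc_k \<phi> n z))\<^sup>2) / (pi * (1 - (cmod z)\<^sup>2)\<^sup>2))) \<and>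
             (\<forall>z. cmod z \<noteq> 1 \<and> poly (star_poly (\<phi> (Suc n))) z = 0 \<longrightarrow>
               (\<exists>L. ((\<lambda>w. cmod (opuc_k \<phi> n w)) \<longlongrightarrow> L) (at z) \<and>
                 intensity n f z =
                   complex_of_real ((1 - L\<^sup>2) / (pi * (1 - (cmod z)\<^sup>2)\<^sup>2)))))"
proof (intro conjI allI impI ballI)
  fix \<mu> :: "real measure" and p z
  assume *: "oprl \<mu> p \<and> (\<forall>j\<le>n. f j = map_poly complex_of_real (p j))"
  show "intensity n f z = complex_of_real ((1 - (oprl_h p n z)\<^sup>2) / (4 * pi * (Im z)\<^sup>2))"
    if "z \<notin> \<real>"
    using * that by (intro oprl_intensity(1)) (auto simp: complex_is_Real_iff)
  show "((\<lambda>w. complex_of_real ((1 - (oprl_h p n w)\<^sup>2) / (4 * pi * (Im w)\<^sup>2)))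
      \<longlongrightarrow> intensity n f z) (at z within - \<real>)"
    using * by (intro oprl_intensity(2)) auto
next
  fix \<mu> :: "complex measure" and \<phi> z
  assume *: "opuc \<mu> \<phi> \<and> conjugate_symmetric \<mu> \<and> (\<forall>j\<le>n. f j = \<phi> j)"
  note facts = opuc_intensity[of \<mu> \<phi> n f z]
  show "cmod z > 1" if "poly (star_poly (\<phi> (Suc n))) z = 0"
    using * that facts(1) by blast
  show "intensity n f z =
      complex_of_real ((1 - (cmod (opuc_k \<phi> n z))\<^sup>2) / (pi * (1 - (cmod z)\<^sup>2)\<^sup>2))"
    if "cmod z \<noteq> 1 \<and> poly (star_poly (\<phi> (Suc n))) z \<noteq> 0"
    using * that facts(2) by blast
  show "\<exists>L. (\<lambda>w. cmod (opuc_k \<phi> n w)) \<midarrow>z\<rightarrow> L \<and>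
      intensity n f z = complex_of_real ((1 - L\<^sup>2) / (pi * (1 - (cmod z)\<^sup>2)\<^sup>2))"
    if "cmod z \<noteq> 1 \<and> poly (star_poly (\<phi> (Suc n))) z = 0"
    using * that facts(3) by blast
qed

end
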